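(* Let $\Gamma_1(4)^{\geq 0}$ denote the set of matrices $\begin{pmatrix} a & b\\ c & d\end{pmatrix}\in\mathrm{SL}(2,\mathbb{Z})$ with $a,b,c,d\geq 0$, $a\equiv d\equiv 1\pmod 4$ and $c\equiv 0\pmod 4$. Let \[\Psi:=\left\{\begin{pmatrix} a & b\\ c & d\end{pmatrix}\in\Gamma_1(4)^{\geq 0}:\ \left(\tfrac{x}{y}\right)=\left(\tfrac{ax+by}{cx+dy}\right)\text{ for all } x,y\in\mathbb{Z}^{\geq 0}\text{ with } y \text{ odd}\right\}.\] Then \[\Psi=\left\{\begin{pmatrix} a & b\\ c & d\end{pmatrix}\in\Gamma_1(4)^{\geq 0}:\ \left(\tfrac{a}{b}\right)=1\right\}.\]
   Context: $\left(\frac{x}{y}\right)$ denotes the Kronecker symbol, defined for all pairs of integers; it is $\pm1$ if $x,y$ are coprime and $0$ otherwise. *)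

theory Defs
  imports "HOL-Analysis.Analysis" "HOL-Number_Theory.Number_Theory"
begin

definition kronecker_prime :: "int \<Rightarrow> int \<Rightarrow> int" where
  "kronecker_prime x p =
     (if p = 2 then (if even x then 0 else if x mod 8 \<in> {1, 7} then 1 else -1)
      else Legendre x p)"

(* The factor before the product is (x/u), where u is the sign of y; integer primes in
   prime_factorization are positive. *)
definition kronecker :: "int \<Rightarrow> int \<Rightarrow> int" where
  "kronecker x y =
     (if y = 0 then (if \<bar>x\<bar> = 1 then 1 else 0)
      else (if y < 0 \<and> x < 0 then -1 else 1) *
           (\<Prod>p\<in>#prime_factorization y. kronecker_prime x p))"

definition Gamma1_4_nonneg :: "(int^2^2) set" where
  "Gamma1_4_nonneg =
     {A. det A = 1 \<and> (\<forall>i j. A $ i $ j \<ge> 0) \<and>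
         [A $ 1 $ 1 = 1] (mod 4) \<and> [A $ 2 $ 2 = 1] (mod 4) \<and> [A $ 2 $ 1 = 0] (mod 4)}"

definition Psi :: "(int^2^2) set" where
  "Psi =
     {A \<in> Gamma1_4_nonneg.
        \<forall>x y. x \<ge> 0 \<and> y \<ge> 0 \<and> odd y \<longrightarrow>
          kronecker x y =
          kronecker (A $ 1 $ 1 * x + A $ 1 $ 2 * y) (A $ 2 $ 1 * x + A $ 2 $ 2 * y)}"

end

theory Submission
  imports Defs
begin

text \<open>
  Put \<open>n = a x + b y\<close> and \<open>m = c x + d y\<close>. Suppose first that \<open>d\<close> is prime to \<open>m\<close>. Since
  \<open>d n - b m = x\<close>, we have \<open>(n/m) = (d/m) (x/m)\<close>. As \<open>m \<equiv> d y\<close> modulo \<open>4 x\<close>, the second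
  factor is \<open>(x/d) (x/y)\<close>; as \<open>d \<equiv> 1\<close> modulo \<open>4\<close>, reciprocity turns the first into
  \<open>(m/d) = (c/d) (x/d)\<close>. Hence \<open>(n/m) = (c/d) (x/y)\<close>. Replacing \<open>d\<close> by \<open>d + k c\<close> and \<open>x\<close> by
  \<open>x - k y\<close> reduces the general case to this one. Finally
  \<open>(a/b) = (b/a) = (c/a) = (c/d)\<close>, using \<open>b c \<equiv> -1\<close> modulo \<open>a\<close> and \<open>a d \<equiv> 1\<close> modulo \<open>c\<close>.
\<close>

section \<open>Legendre symbols at odd primes\<close>

lemma Legendre_cong:
  assumes "[a = b] (mod p)"
  shows "Legendre a p = Legendre b p"
proof -
  have "QuadRes p a = QuadRes p b" "[a = 0] (mod p) = [b = 0] (mod p)"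
    using assms by (auto simp: QuadRes_def cong_def)
  then show ?thesis by (simp add: Legendre_def)
qed

lemma Legendre_range: "Legendre a p \<in> {-1, 0, 1}"
  by (simp add: Legendre_def)

text \<open>Two elements of {-1, 0, 1} differ by at most 2, which is less than \<open>p\<close>.
  This turns Euler's criterion into equalities of integers.\<close>

lemma Legendre_eqI:
  assumes "[Legendre a p = x] (mod p)" "x \<in> {-1, 0, 1}" "p > 2"
  shows "Legendre a p = x"
proof -
  have "p dvd Legendre a p - x" using assms(1) by (simp add: cong_iff_dvd_diff)
  moreover have "\<bar>Legendre a p - x\<bar> < p"
    using assms(2,3) Legendre_range[of a p] by auto
  ultimately show ?thesis using dvd_imp_le_int[of "Legendre a p - x" p] by force
qed

lemma euler_criterion_int:
  fixes p :: int
  assumes "prime p" "p > 2"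
  shows "[Legendre a p = a ^ ((nat p - 1) div 2)] (mod p)"
proof -
  have "prime (nat p)" using assms(1) prime_int_nat_transfer by blast
  moreover have "2 < nat p" "int (nat p) = p" using assms(2) by auto
  ultimately show ?thesis using euler_criterion[of "nat p" a] by simp
qed

lemma Legendre_mult:
  fixes p :: int
  assumes "prime p" "p > 2"
  shows "Legendre (a * b) p = Legendre a p * Legendre b p"
proof (rule Legendre_eqI[OF _ _ assms(2)])
  show "[Legendre (a * b) p = Legendre a p * Legendre b p] (mod p)"
    using cong_mult[OF euler_criterion_int[OF assms, of a] euler_criterion_int[OF assms, of b]]
      euler_criterion_int[OF assms, of "a * b"]
    by (metis power_mult_distrib cong_sym cong_trans)
  show "Legendre a p * Legendre b p \<in> {-1, 0, 1}"
    using Legendre_range[of a p] Legendre_range[of b p] by auto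
qed

lemma Legendre_minus_one:
  fixes p :: int
  assumes "prime p" "p > 2"
  shows "Legendre (-1) p = (if p mod 4 = 1 then 1 else -1)"
proof (rule Legendre_eqI[OF _ _ assms(2)])
  obtain n where n: "p = int n" using assms(2) by (intro that[of "nat p"]) simp
  have "odd p" using assms prime_odd_int by blast
  then have "odd n" unfolding n by simp
  then have "even ((n - 1) div 2) \<longleftrightarrow> n mod 4 = 1" by presburger
  moreover have "n mod 4 = 1 \<longleftrightarrow> p mod 4 = 1" unfolding n by presburger
  ultimately have "(-1) ^ ((nat p - 1) div 2) = (if p mod 4 = 1 then 1 else -1 :: int)"
    unfolding n by (simp add: minus_one_power_iff)
  then show "[Legendre (-1) p = (if p mod 4 = 1 then 1 else -1)] (mod p)"
    using euler_criterion_int[OF assms, of "-1"] by simp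
qed simp

lemma Legendre_eq_0_iff: "Legendre a p = 0 \<longleftrightarrow> p dvd a"
  by (simp add: Legendre_def cong_0_iff)

lemma Legendre_reciprocity:
  fixes p q :: int
  assumes "prime p" "p > 2" "prime q" "q > 2"
  shows "Legendre p q = (if p mod 4 = 3 \<and> q mod 4 = 3 then -1 else 1) * Legendre q p"
proof (cases "p = q")
  case True
  \<comment> \<open>Both symbols are 0, so either sign works.\<close>
  then show ?thesis by (simp add: Legendre_def cong_def)
next
  case False
  have "odd p" "odd q" using assms prime_odd_int by blast+
  then have "even ((p - 1) div 2) \<longleftrightarrow> p mod 4 \<noteq> 3" "even ((q - 1) div 2) \<longleftrightarrow> q mod 4 \<noteq> 3"
    by presburger+
  moreover have "(p - 1) div 2 * ((q - 1) div 2) \<ge> 0"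
    using assms by (intro mult_nonneg_nonneg) auto
  ultimately have "even (nat ((p - 1) div 2 * ((q - 1) div 2))) \<longleftrightarrow> \<not> (p mod 4 = 3 \<and> q mod 4 = 3)"
    by (metis even_nat_iff even_mult_iff)
  moreover have "prime (nat p)" "prime (nat q)"
    using assms(1,3) prime_int_nat_transfer by blast+
  ultimately have "Legendre p q * Legendre q p = (if p mod 4 = 3 \<and> q mod 4 = 3 then -1 else 1)"
    using Quadratic_Reciprocity_int[of p q] assms(2,4) False by (metis minus_one_power_iff)
  \<comment> \<open>Two values in {-1, 0, 1} whose product is 1 or -1 are signs, so one factor can
    be moved across.\<close>
  then show ?thesis
    using Legendre_range[of p q] Legendre_range[of q p] by (auto split: if_splits)
qed

section \<open>Kronecker symbols with positive lower argument\<close>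

lemma pos_int_prime_induct [consumes 1, case_names one mult]:
  fixes n :: int
  assumes "n > 0" "P 1" "\<And>p n. prime p \<Longrightarrow> n > 0 \<Longrightarrow> P n \<Longrightarrow> P (p * n)"
  shows "P n"
proof -
  have "n > 0 \<longrightarrow> P n"
  proof (induction n rule: prime_divisors_induct)
    case (unit x)
    then show ?case using assms(2) by auto
  next
    case (factor p x)
    then show ?case using assms(3) prime_gt_0_int[of p] by (auto simp: zero_less_mult_iff)
  qed simp
  then show ?thesis using assms(1) by blast
qed

lemma kronecker_one_right [simp]: "kronecker x 1 = 1"
  by (simp add: kronecker_def)

text \<open>Positivity removes the sign factor and the special value at 0, leaving only the product
  over primes.\<close>

lemma kronecker_mult_right:
  assumes "m > 0" "n > 0"
  shows "kronecker x (m * n) = kronecker x m * kronecker x n"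
proof -
  have "\<not> m * n < 0" using mult_pos_pos[OF assms] by linarith
  then show ?thesis using assms by (simp add: kronecker_def prime_factorization_mult)
qed

lemma kronecker_prime_right:
  fixes p :: int
  assumes "prime p"
  shows "kronecker x p = kronecker_prime x p"
  using assms prime_gt_0_int[of p] by (simp add: kronecker_def prime_factorization_prime)

lemma kronecker_odd_prime:
  fixes p :: int
  assumes "prime p" "odd p"
  shows "kronecker x p = Legendre x p" "p > 2"
  using assms prime_ge_2_int[of p]
  by (auto simp: kronecker_prime_right kronecker_prime_def order.order_iff_strict)

text \<open>Each odd prime factor of \<open>m\<close> gives a Legendre symbol, whose period divides
  \<open>m\<close>. Oddness matters: at 2 the symbol depends on \<open>x\<close> modulo 8.\<close>

lemma kronecker_cong_left:
  assumes "m > 0" "odd m" "[x = x'] (mod m)"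
  shows "kronecker x m = kronecker x' m"
  using assms
proof (induction rule: pos_int_prime_induct)
  case (mult p n)
  have "kronecker x p = kronecker x' p"
    using mult kronecker_odd_prime(1) Legendre_cong[of x x' p] cong_dvd_modulus[of x x' "p * n" p]
    by simp
  moreover have "kronecker x n = kronecker x' n"
    using mult cong_dvd_modulus[of x x' "p * n" n] by simp
  ultimately show ?case
    using mult.hyps prime_gt_0_int by (simp add: kronecker_mult_right)
qed simp

lemma kronecker_mult_left:
  assumes "m > 0" "odd m"
  shows "kronecker (x * y) m = kronecker x m * kronecker y m"
  using assms
proof (induction rule: pos_int_prime_induct)
  case (mult p n)
  then show ?case
    using kronecker_odd_prime[of p] prime_gt_0_int[of p]
    by (simp add: kronecker_mult_right Legendre_mult)
qed simp

lemma kronecker_one_left [simp]: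
  assumes "m > 0" "odd m"
  shows "kronecker 1 m = 1"
  using assms
proof (induction rule: pos_int_prime_induct)
  case (mult p n)
  have "Legendre 1 p = 1"
    using prime_gt_1_int[OF mult.hyps(1)]
    by (auto simp: Legendre_def QuadRes_def cong_def intro: exI[of _ 1])
  with mult show ?case
    using kronecker_odd_prime[of p] prime_gt_0_int[of p]
    by (simp add: kronecker_mult_right)
qed simp

text \<open>No prime factor of \<open>m\<close> divides \<open>x\<close>, so every Legendre factor
  is a sign. This is what allows symbols to be cancelled later.\<close>

lemma kronecker_square_left:
  assumes "m > 0" "odd m" "coprime x m"
  shows "kronecker x m * kronecker x m = 1"
  using assms
proof (induction rule: pos_int_prime_induct)
  case (mult p n)
  have "Legendre x p \<noteq> 0"
    using mult by (metis Legendre_eq_0_iff coprime_common_divisor dvd_triv_left not_prime_unit)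
  then have "Legendre x p * Legendre x p = 1"
    using Legendre_range[of x p] by auto
  moreover have "kronecker x n * kronecker x n = 1"
    using mult by simp
  moreover have "kronecker x (p * n) = Legendre x p * kronecker x n"
    using mult kronecker_odd_prime[of p] prime_gt_0_int[of p] by (simp add: kronecker_mult_right)
  ultimately show ?case
    by (metis mult.assoc mult.left_commute mult_1_right)
qed simp

section \<open>Supplementary laws and quadratic reciprocity\<close>

lemma odd_mult_mod_4:
  fixes m n :: int
  assumes "odd m" "odd n"
  shows "(m * n) mod 4 = (if m mod 4 = n mod 4 then 1 else 3)"
proof -
  have "m mod 4 = 1 \<or> m mod 4 = 3" "n mod 4 = 1 \<or> n mod 4 = 3" using assms by presburger+
  then have "(m mod 4) * (n mod 4) mod 4 = (if m mod 4 = n mod 4 then 1 else 3)"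
    by (elim disjE) simp_all
  then show ?thesis by (simp only: mod_mult_eq)
qed

lemma kronecker_minus_one_left:
  assumes "m > 0" "odd m"
  shows "kronecker (-1) m = (if m mod 4 = 1 then 1 else -1)"
  using assms
proof (induction rule: pos_int_prime_induct)
  case (mult p n)
  have "odd p" "odd n" using mult.prems by auto
  then have "p mod 4 = 1 \<or> p mod 4 = 3" "n mod 4 = 1 \<or> n mod 4 = 3" by presburger+
  with \<open>odd p\<close> \<open>odd n\<close> mult show ?case
    using kronecker_odd_prime[of p] prime_gt_0_int[of p]
    by (auto simp: kronecker_mult_right Legendre_minus_one odd_mult_mod_4)
qed simp

text \<open>For odd positive \<open>m\<close> and \<open>n\<close> this is (-1)^((m-1)/2 * (n-1)/2).
  Stated by residues, its multiplicativity is a finite case check.\<close>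

definition reciprocity_sign :: "int \<Rightarrow> int \<Rightarrow> int" where
  "reciprocity_sign m n = (if m mod 4 = 3 \<and> n mod 4 = 3 then -1 else 1)"

lemma reciprocity_sign_commute: "reciprocity_sign m n = reciprocity_sign n m"
  by (auto simp: reciprocity_sign_def)

lemma reciprocity_sign_mult:
  assumes "odd m" "odd n"
  shows "reciprocity_sign (m * n) k = reciprocity_sign m k * reciprocity_sign n k"
proof -
  have "m mod 4 = 1 \<or> m mod 4 = 3" "n mod 4 = 1 \<or> n mod 4 = 3" using assms by presburger+
  then show ?thesis using assms by (auto simp: reciprocity_sign_def odd_mult_mod_4)
qed

text \<open>Both sides are multiplicative in \<open>m\<close>, which reduces the claim to two odd
  primes. If \<open>q\<close> divides \<open>m\<close>, both symbols are 0.\<close>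

lemma kronecker_reciprocity_prime:
  fixes q :: int
  assumes "m > 0" "odd m" "prime q" "odd q"
  shows "kronecker q m = reciprocity_sign m q * kronecker m q"
  using assms(1,2)
proof (induction rule: pos_int_prime_induct)
  case one
  then show ?case
    using assms prime_gt_0_int[of q] by (simp add: reciprocity_sign_def)
next
  case (mult p n)
  have "kronecker q p = reciprocity_sign p q * kronecker p q"
    using mult assms kronecker_odd_prime[of p] kronecker_odd_prime[of q] Legendre_reciprocity[of q p]
    by (auto simp: reciprocity_sign_def)
  moreover have "kronecker (p * n) q = kronecker p q * kronecker n q"
    using assms prime_gt_0_int[of q] by (simp add: kronecker_mult_left)
  moreover have "kronecker q (p * n) = kronecker q p * kronecker q n"
    using mult prime_gt_0_int[of p] by (simp add: kronecker_mult_right)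
  ultimately show ?case
    using mult by (simp add: reciprocity_sign_mult)
qed

text \<open>A second induction, now on \<open>n\<close>, with the prime case as input at each
  step.\<close>

lemma kronecker_reciprocity:
  assumes "m > 0" "odd m" "n > 0" "odd n"
  shows "kronecker n m = reciprocity_sign m n * kronecker m n"
  using assms(3,4)
proof (induction rule: pos_int_prime_induct)
  case one
  then show ?case using assms by (simp add: reciprocity_sign_def)
next
  case (mult q n)
  have "kronecker (q * n) m = kronecker q m * kronecker n m"
    using assms by (simp add: kronecker_mult_left)
  moreover have "kronecker m (q * n) = kronecker m q * kronecker m n"
    using mult prime_gt_0_int[of q] by (simp add: kronecker_mult_right)
  moreover have "reciprocity_sign m (q * n) = reciprocity_sign m q * reciprocity_sign m n"
    using mult reciprocity_sign_mult[of q n m] by (simp add: reciprocity_sign_commute)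
  ultimately show ?case
    using mult kronecker_reciprocity_prime[OF assms(1,2), of q] by simp
qed

text \<open>Since \<open>2 \<equiv> -(m - 2)\<close> modulo \<open>m\<close> and one of \<open>m\<close>, \<open>m - 2\<close> is \<open>1\<close> modulo \<open>4\<close>,
  reciprocity gives \<open>(2/m) = (-1/m) (2/(m-2))\<close>.\<close>

lemma kronecker_two_left_nat:
  "kronecker 2 (2 * int k + 1) = (if k mod 4 = 0 \<or> k mod 4 = 3 then 1 else -1)"
proof (induction k)
  case (Suc k)
  define m where "m = 2 * int k + 3"
  have m: "m > 0" "odd m" "m - 2 > 0" "odd (m - 2)" by (auto simp: m_def)
  have "kronecker 2 m = kronecker (-1 * (m - 2)) m"
    using m by (intro kronecker_cong_left) (auto simp: cong_iff_dvd_diff)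
  also have "\<dots> = kronecker (-1) m * kronecker (m - 2) m"
    using m by (intro kronecker_mult_left)
  also have "kronecker (m - 2) m = kronecker m (m - 2)"
  proof -
    have "reciprocity_sign m (m - 2) = 1"
      by (simp add: reciprocity_sign_def) presburger
    then show ?thesis using kronecker_reciprocity[OF m] by simp
  qed
  also have "kronecker m (m - 2) = kronecker 2 (m - 2)"
    using m by (intro kronecker_cong_left) (auto simp: cong_iff_dvd_diff)
  finally have "kronecker 2 m = kronecker (-1) m * kronecker 2 (m - 2)" .
  moreover have "2 * int (Suc k) + 1 = m" "m - 2 = 2 * int k + 1" by (simp_all add: m_def)
  moreover have "m mod 4 = 1 \<longleftrightarrow> k mod 4 = 1 \<or> k mod 4 = 3" unfolding m_def by presburger
  ultimately have eq: "kronecker 2 (2 * int (Suc k) + 1) =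
      (if k mod 4 = 1 \<or> k mod 4 = 3 then 1 else -1) * (if k mod 4 = 0 \<or> k mod 4 = 3 then 1 else -1)"
    using Suc.IH kronecker_minus_one_left[OF m(1,2)] by (simp only:)
  \<comment> \<open>For \<open>k\<close> = 0, 1, 2, 3 modulo 4 the recursion turns the signs +, -,
    -, + into -, -, +, +, which is the same pattern shifted by one.\<close>
  have "k mod 4 = 0 \<or> k mod 4 = 1 \<or> k mod 4 = 2 \<or> k mod 4 = 3" by presburger
  then show ?case unfolding eq mod_Suc by (elim disjE) simp_all
qed simp

lemma kronecker_two_left:
  assumes "m > 0" "odd m"
  shows "kronecker 2 m = (if m mod 8 \<in> {1, 7} then 1 else -1)"
proof -
  obtain j where j: "m = 2 * j + 1" using assms(2) by (elim oddE)
  then obtain k where k: "j = int k" using assms(1) by (intro that[of "nat j"]) simp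
  have "m mod 8 = 1 \<or> m mod 8 = 7 \<longleftrightarrow> k mod 4 = 0 \<or> k mod 4 = 3"
    unfolding j k by presburger
  then show ?thesis using kronecker_two_left_nat[of k] unfolding j k by simp
qed

section \<open>Periodicity in the lower argument\<close>

lemma kronecker_cong_right_pos:
  assumes "x > 0" "m > 0" "odd m" "m' > 0" "odd m'" "[m = m'] (mod (4 * x))"
  shows "kronecker x m = kronecker x m'"
  using assms(1,6)
proof (induction rule: pos_int_prime_induct)
  case one
  then show ?case using assms by simp
next
  case (mult p n)
  have 4: "[m = m'] (mod 4)" and p: "[m = m'] (mod p)" and n: "[m = m'] (mod (4 * n))"
    by (rule cong_dvd_modulus[OF mult.prems]; simp)+
  have "kronecker p m = kronecker p m'"
  proof (cases "p = 2")
    case True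
    \<comment> \<open>With \<open>p = 2\<close> the modulus \<open>4 * (p * n)\<close> is a multiple
      of 8, the period of (2/m).\<close>
    have "[m = m'] (mod 8)"
      by (rule cong_dvd_modulus[OF mult.prems]) (simp add: True)
    then show ?thesis
      using assms by (simp add: True kronecker_two_left cong_def)
  next
    case False
    then have "odd p" using mult.hyps(1) prime_odd_int[of p] prime_ge_2_int[of p] by auto
    \<comment> \<open>After flipping to (m/p), the symbol depends on \<open>m\<close> modulo
      \<open>p\<close> and the sign on \<open>m\<close> modulo 4.\<close>
    moreover have "reciprocity_sign m p = reciprocity_sign m' p"
      using 4 by (simp add: reciprocity_sign_def cong_def)
    moreover have "kronecker m p = kronecker m' p"
      using mult.hyps(1) \<open>odd p\<close> p prime_gt_0_int by (intro kronecker_cong_left)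
    ultimately show ?thesis
      using assms mult.hyps by (simp add: kronecker_reciprocity_prime)
  qed
  then show ?case
    using mult n assms by (simp add: kronecker_mult_left)
qed

text \<open>A negative \<open>x\<close> contributes a further factor (-1/m), which is determined by
  \<open>m\<close> modulo 4.\<close>

lemma kronecker_cong_right:
  assumes "m > 0" "odd m" "m' > 0" "odd m'" "[m = m'] (mod (4 * x))"
  shows "kronecker x m = kronecker x m'"
proof (cases x "0 :: int" rule: linorder_cases)
  case less
  have "[m = m'] (mod (4 * - x))"
    using assms(5) by (simp add: cong_iff_dvd_diff)
  then have pos: "kronecker (- x) m = kronecker (- x) m'"
    using assms less by (intro kronecker_cong_right_pos) auto
  have "[m = m'] (mod 4)"
    by (rule cong_dvd_modulus[OF assms(5)]) simp
  then have "kronecker (-1) m = kronecker (-1) m'"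
    using assms by (simp add: kronecker_minus_one_left cong_def)
  then show ?thesis
    using pos assms kronecker_mult_left[of m "-1" "- x"] kronecker_mult_left[of m' "-1" "- x"] by simp
next
  case equal
  \<comment> \<open>The modulus is 0, so \<open>m = m'\<close>.\<close>
  then show ?thesis using assms(5) by (simp add: cong_def)
next
  case greater
  then show ?thesis using assms by (intro kronecker_cong_right_pos)
qed

text \<open>The square 4 does not affect a symbol with odd lower argument, so dividing it out of
  \<open>x\<close> lowers the modulus from \<open>4 * x\<close> to \<open>x\<close>.\<close>

lemma kronecker_cong_right_of_four_dvd:
  assumes "m > 0" "odd m" "m' > 0" "odd m'" "4 dvd x" "[m = m'] (mod x)"
  shows "kronecker x m = kronecker x m'"
proof -
  obtain z where z: "x = 4 * z" using assms(5) by (elim dvdE)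
  have "kronecker (4 * z) n = kronecker z n" if "n > 0" "odd n" for n
    using that kronecker_mult_left[of n 2 "2 * z"] kronecker_mult_left[of n 2 z]
      kronecker_square_left[of n 2] by simp
  then show ?thesis
    using kronecker_cong_right[of m m' z] assms z by simp
qed

text \<open>No sign arises because \<open>a\<close> is 1 modulo 4. Even \<open>b\<close> is covered
  since the defining rule for (a/2) agrees with the formula for (2/a).\<close>

lemma kronecker_reciprocity_one_mod_four:
  assumes "a > 0" "a mod 4 = 1" "b > 0"
  shows "kronecker a b = kronecker b a"
  using assms(3)
proof (induction rule: pos_int_prime_induct)
  have a: "odd a" using assms(2) by presburger
  case one
  then show ?case using assms a by simp
next
  have a: "odd a" using assms(2) by presburger
  case (mult p n)
  have "kronecker a p = kronecker p a"
  proof (cases "p = 2")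
    case True
    then show ?thesis
      using assms a by (simp add: kronecker_prime_right kronecker_prime_def kronecker_two_left)
  next
    case False
    then have "odd p" using mult.hyps(1) prime_odd_int[of p] prime_ge_2_int[of p] by auto
    then show ?thesis
      using kronecker_reciprocity_prime[of a p] assms a mult.hyps by (simp add: reciprocity_sign_def)
  qed
  then show ?case
    using mult assms a prime_gt_0_int[of p] by (simp add: kronecker_mult_right kronecker_mult_left)
qed

section \<open>Transformation of the symbol under a matrix\<close>

lemma exists_coprime_in_progression:
  fixes c d m :: int
  assumes "coprime c d" "m \<noteq> 0"
  obtains k where "k \<ge> 0" "coprime (d + c * k) m"
proof -
  \<comment> \<open>A prime factor of \<open>m\<close> divides exactly one of \<open>d\<close> and
    \<open>c\<close> times the product of \<open>S\<close>: if it divides \<open>d\<close>, it is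
    prime to \<open>c\<close> and outside \<open>S\<close>; otherwise it lies in \<open>S\<close>.
    Hence it does not divide their sum.\<close>
  define S where "S = {p \<in> prime_factors m. \<not> p dvd d}"
  have S: "finite S" "\<And>p. p \<in> S \<Longrightarrow> prime p" by (auto simp: S_def)
  have dvd_prod: "p dvd \<Prod>S \<longleftrightarrow> p \<in> S" if "prime p" for p
    using that S by (metis dvd_prodI id_apply prime_dvd_prod_iff primes_dvd_imp_eq prod.cong)
  have "coprime (d + c * \<Prod>S) m"
  proof (rule ccontr)
    assume "\<not> coprime (d + c * \<Prod>S) m"
    then obtain p where p: "prime p" "p dvd d + c * \<Prod>S" "p dvd m"
      using prime_factor_int[of "gcd (d + c * \<Prod>S) m"] assms(2)
      by (auto simp: coprime_iff_gcd_eq_1)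
    show False
    proof (cases "p dvd d")
      case True
      then have "p dvd c * \<Prod>S" using p(2) by (simp add: dvd_add_right_iff)
      moreover have "\<not> p dvd c"
        using assms(1) True p(1) by (meson coprime_common_divisor not_prime_unit)
      ultimately show False
        using True p(1) dvd_prod by (auto simp: prime_dvd_mult_iff S_def)
    next
      case False
      then have "p dvd \<Prod>S"
        using p assms(2) dvd_prod by (auto simp: S_def in_prime_factors_iff)
      then show False using False p(2) by (simp add: dvd_add_left_iff)
    qed
  qed
  moreover have "\<Prod>S \<ge> 0"
    using S(2) prime_ge_0_int by (intro prod_nonneg) blast
  ultimately show ?thesis using that by blast
qed

theorem kronecker_moebius:
  fixes a b c d x y :: int
  assumes det: "a * d - b * c = 1"
    and c: "c \<ge> 0" "4 dvd c" and d: "d > 0" "d mod 4 = 1"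
    and x: "x \<ge> 0" and y: "y > 0" "odd y"
  shows "kronecker (a * x + b * y) (c * x + d * y) = kronecker c d * kronecker x y"
proof -
  define n where "n = a * x + b * y"
  define m where "m = c * x + d * y"
  have oddd: "odd d" using d(2) by presburger
  have evc: "even c" using c(2) by presburger
  have m: "m > 0" "odd m"
    using c d x y oddd evc by (auto simp: m_def add_nonneg_pos)
  have "coprime c d"
    by (rule coprimeI) (metis det dvd_diff dvd_mult dvd_mult2 mult.commute)
  then obtain k where k: "k \<ge> 0" "coprime (d + c * k) m"
    using exists_coprime_in_progression[of c d m] m by auto
  \<comment> \<open>Adding \<open>k\<close> times the first column to the second, while replacing
    \<open>x\<close> by \<open>x - k * y\<close>, preserves \<open>n\<close>, \<open>m\<close> and
    the determinant. The new \<open>x'\<close> may be negative.\<close>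
  define d' where "d' = d + c * k"
  define x' where "x' = x - k * y"
  define b' where "b' = b + a * k"
  have d': "d' > 0" "d' mod 4 = 1" "odd d'" "coprime d' m"
  proof -
    show "d' > 0" using c d k by (simp add: d'_def add_pos_nonneg)
    show "d' mod 4 = 1" using c d
      by (metis d'_def dvd_mult2 mod_add_right_eq dvd_imp_mod_0 add.right_neutral)
    show "odd d'" using oddd evc by (simp add: d'_def)
    show "coprime d' m" using k by (simp add: d'_def)
  qed
  have m_eq: "m = c * x' + d' * y"
    by (simp add: m_def x'_def d'_def algebra_simps)
  \<comment> \<open>This eliminates \<open>y\<close> from \<open>n = a * x' + b' * y\<close> and
    \<open>m = c * x' + d' * y\<close>.\<close>
  have "d' * n - b' * m = (a * d - b * c) * x'"
    by (simp add: n_def m_def x'_def d'_def b'_def algebra_simps)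
  then have "d' * n - x' = b' * m" using det by simp
  then have "[d' * n = x'] (mod m)" by (simp add: cong_iff_dvd_diff)
  then have "kronecker x' m = kronecker d' m * kronecker n m"
    using m kronecker_cong_left[of m "d' * n" x'] kronecker_mult_left[of m d' n] by simp
  then have n_m: "kronecker n m = kronecker d' m * kronecker x' m"
    using kronecker_square_left[of m d'] m d' by (simp flip: mult.assoc)
  \<comment> \<open>The difference \<open>m - d' * y = c * x'\<close> is a multiple of
    \<open>4 * x'\<close> because 4 divides \<open>c\<close>.\<close>
  have "kronecker x' m = kronecker x' (d' * y)"
    using m d' y c(2) by (intro kronecker_cong_right) (auto simp: m_eq cong_iff_dvd_diff)
  then have x'_m: "kronecker x' m = kronecker x' d' * kronecker x' y"
    using d' y by (simp add: kronecker_mult_right)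
  have "kronecker d' m = kronecker m d'"
    using kronecker_reciprocity[of m d'] m d' by (simp add: reciprocity_sign_def)
  also have "\<dots> = kronecker (c * x') d'"
    using d' by (intro kronecker_cong_left) (auto simp: m_eq cong_iff_dvd_diff)
  also have "\<dots> = kronecker c d' * kronecker x' d'"
    using d' by (intro kronecker_mult_left)
  finally have d'_m: "kronecker d' m = kronecker c d' * kronecker x' d'" .
  \<comment> \<open>The symbol (x'/d') occurs in both (d'/m) and (x'/m); coprimality makes its
    square 1.\<close>
  have "coprime x' d'"
  proof (rule coprimeI)
    fix z assume "z dvd x'" "z dvd d'"
    then have "z dvd m" by (simp add: m_eq)
    with d'(4) \<open>z dvd d'\<close> show "is_unit z" by (rule coprime_common_divisor)
  qed
  then have "kronecker x' d' * kronecker x' d' = 1"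
    using d' by (intro kronecker_square_left)
  then have "kronecker n m = kronecker c d' * kronecker x' y"
    unfolding n_m x'_m d'_m by (simp add: mult.assoc mult.left_commute)
  \<comment> \<open>The construction gives \<open>d'\<close> congruent to \<open>d\<close> modulo
    \<open>c\<close>, not modulo \<open>4 * c\<close>; this is where the smaller period is
    used.\<close>
  also have "kronecker c d' = kronecker c d"
    using c d d' oddd by (intro kronecker_cong_right_of_four_dvd) (auto simp: d'_def cong_iff_dvd_diff)
  also have "kronecker x' y = kronecker x y"
    using y by (intro kronecker_cong_left) (auto simp: x'_def cong_iff_dvd_diff)
  finally show ?thesis by (simp add: n_def m_def)
qed

section \<open>Comparison of the two rows and the description of \<open>Psi\<close>\<close>

lemma kronecker_top_row_eq_bottom_row:
  fixes a b c d :: int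
  assumes det: "a * d - b * c = 1"
    and "a > 0" "b \<ge> 0" "d > 0" and mod4: "a mod 4 = 1" "d mod 4 = 1" "4 dvd c"
  shows "kronecker a b = kronecker c d"
proof (cases "b = 0")
  case True
  \<comment> \<open>Here \<open>a * d = 1\<close>, and the claim becomes (1/0) = (c/1), where both
    values are 1.\<close>
  then have "a = 1" "d = 1" using det assms(2,4) by (auto simp: zmult_eq_1_iff)
  then show ?thesis using True by (simp add: kronecker_def[of 1 0])
next
  case False
  have odd: "odd a" "odd d" using mod4 by presburger+
  have ca: "coprime c a"
    by (rule coprimeI) (metis det dvd_diff dvd_mult dvd_mult2 mult.commute)
  have cd: "coprime c d"
    by (rule coprimeI) (metis det dvd_diff dvd_mult dvd_mult2 mult.commute)
  have "b * c - (-1) = a * d" using det by simp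
  then have "[b * c = -1] (mod a)" by (metis cong_iff_dvd_diff dvd_triv_left)
  then have "kronecker b a * kronecker c a = kronecker (-1) a"
    using assms odd by (metis kronecker_cong_left kronecker_mult_left)
  then have "kronecker b a * kronecker c a = 1"
    using assms odd by (simp add: kronecker_minus_one_left)
  \<comment> \<open>Since (c/a) is a sign, it is its own inverse.\<close>
  then have ba: "kronecker b a = kronecker c a"
    by (metis ca assms(2) kronecker_square_left mult.commute mult.left_commute mult_1_right odd(1))
  have "a * d - 1 = b * c" using det by simp
  then have "[a * d = 1] (mod c)" by (simp add: cong_iff_dvd_diff)
  then have "kronecker c (a * d) = kronecker c 1"
    using assms odd by (intro kronecker_cong_right_of_four_dvd) auto
  then have "kronecker c a * kronecker c d = 1"
    using assms by (simp add: kronecker_mult_right)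
  then have "kronecker c a = kronecker c d"
    by (metis cd assms(4) kronecker_square_left mult.commute mult.left_commute mult_1_right odd(2))
  then show ?thesis
    using ba kronecker_reciprocity_one_mod_four[of a b] assms False by simp
qed

theorem theorem2p2:
  shows "Psi = {A \<in> Gamma1_4_nonneg. kronecker (A $ 1 $ 1) (A $ 1 $ 2) = 1}"
proof -
  have key: "(\<forall>x y. x \<ge> 0 \<and> y \<ge> 0 \<and> odd y \<longrightarrow> kronecker x y =
        kronecker (A $ 1 $ 1 * x + A $ 1 $ 2 * y) (A $ 2 $ 1 * x + A $ 2 $ 2 * y))
      \<longleftrightarrow> kronecker (A $ 1 $ 1) (A $ 1 $ 2) = 1" (is "?L \<longleftrightarrow> ?R")
    if A: "A \<in> Gamma1_4_nonneg" for A :: "int^2^2"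
  proof -
    define a b c d where abcd: "a = A $ 1 $ 1" "b = A $ 1 $ 2" "c = A $ 2 $ 1" "d = A $ 2 $ 2"
    have det: "a * d - b * c = 1" and nonneg: "a \<ge> 0" "b \<ge> 0" "c \<ge> 0" "d \<ge> 0"
      and mod4: "a mod 4 = 1" "d mod 4 = 1" "4 dvd c"
      using A by (auto simp: Gamma1_4_nonneg_def det_2 abcd cong_def)
    \<comment> \<open>The residue 1 modulo 4 excludes 0 on the diagonal.\<close>
    then have pos: "a > 0" "d > 0" by (auto simp: order.order_iff_strict)
    have ab: "kronecker a b = kronecker c d"
      using det pos nonneg mod4 by (intro kronecker_top_row_eq_bottom_row)
    have main: "kronecker (a * x + b * y) (c * x + d * y) = kronecker a b * kronecker x y"
      if "x \<ge> 0" "y \<ge> 0" "odd y" for x y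
    proof -
      have "y > 0" using that by (cases "y = 0") auto
      then show ?thesis
        using kronecker_moebius[of a d b c x y] that det pos nonneg mod4 ab by simp
    qed
    have "?L \<longleftrightarrow> (\<forall>x y. x \<ge> 0 \<and> y \<ge> 0 \<and> odd y \<longrightarrow> kronecker x y = kronecker a b * kronecker x y)"
      using main unfolding abcd by auto
    also have "\<dots> \<longleftrightarrow> kronecker a b = 1"
    proof
      assume "\<forall>x y. x \<ge> 0 \<and> y \<ge> 0 \<and> odd y \<longrightarrow> kronecker x y = kronecker a b * kronecker x y"
      \<comment> \<open>The pair (0, 1) isolates the constant, as (0/1) is an empty product and
        equals 1.\<close>
      then have "kronecker 0 1 = kronecker a b * kronecker 0 1" by (metis odd_one order_refl zero_le_one)
      then show "kronecker a b = 1" by simp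
    qed simp
    finally show ?thesis by (simp add: abcd)
  qed
  show ?thesis unfolding Psi_def using key by blast
qed

end
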